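(* Consider the discrete additive group $(\mathbb{Z},+)$, and let $\mathbb{T}=\{z\in\mathbb{C}:|z|=1\}$. (i) For every $k\in\mathbb{N}$, $W_k(\mathbb{Z},+)$ coincides with the norm closure (in $\ell^\infty(\mathbb{Z})$) of the algebra generated by the set of functions $\{n\mapsto\lambda^{n^i} : \lambda\in\mathbb{T},\ i=0,1,\dots,k\}$. (ii) $W(\mathbb{Z},+)$ coincides with the norm closure (in $\ell^\infty(\mathbb{Z})$) of the algebra generated by the set of functions $\{n\mapsto\lambda^{n^k} : \lambda\in\mathbb{T},\ k\in\mathbb{N}\}$ (the Weyl algebra).
   Context: $\mathbb{N}=\{1,2,\dots\}$, and $n^0=1$ for all $n\in\mathbb{Z}$. For a semitopological semigroup $S$ (all left and right translations continuous), $C(S)$ is the $C^*$-algebra of bounded continuous complex-valued functions with the sup norm, and $(L_sf)(t)=f(st)$. $LMC(S)$ is the set of $f\in C(S)$ such that $s\mapsto\mu(L_sf)$ is continuous on $S$ for every $\mu$ in the spectrum of $C(S)$; it is a unital $C^*$-subalgebra, and for $\mu$ in its spectrum $S^{LMC}$ (the nonzero multiplicative linear functionals on $LMC(S)$) the formula $(T_\mu f)(s)=\mu(L_sf)$ defines a map $T_\mu:LMC(S)\to LMC(S)$. Put $\Sigma=\{T_\mu:\mu\in S^{LMC}\}$. For the discrete group $S=\mathbb{Z}$, $C(\mathbb{Z})=LMC(\mathbb{Z})=\ell^\infty(\mathbb{Z})$. Let $F_0$ be the set of constant functions on $S$ of modulus $1$, and inductively for $k\ge 1$ let $$F_k=\{f\in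 LMC(S): |f|=1 \text{ and for every }\sigma\in\Sigma \text{ there is } f_\sigma\in F_{k-1}\text{ with }\sigma(f)=f_\sigma f\},$$ where $|f|=1$ means $|f(s)|=1$ for all $s\in S$. Let $W_k(S)$ and $W(S)$ be the norm closures in $C(S)$ of the (complex) algebras generated by $F_k$ and by $\bigcup_{k\in\mathbb{N}}F_k$, respectively. *)

theory Defs
  imports "HOL-Analysis.Analysis"
begin

text \<open>
  \<open>C(S)\<close> is the library type of bounded continuous functions with the sup metric,
  which here receives its pointwise product. Multiplication by a complex scalar \<open>c\<close>
  is written as the product with \<open>const_bcontfun c\<close>.
\<close>

lemma mult_bcontfun_cont:
  fixes f g :: "'a::topological_space \<Rightarrow> 'b::real_normed_algebra"
  assumes "f \<in> bcontfun" "g \<in> bcontfun"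
  shows "(\<lambda>x. f x * g x) \<in> bcontfun"
proof -
  from assms obtain a b where ab: "\<And>x. norm (f x) \<le> a" "\<And>x. norm (g x) \<le> b"
    by (fastforce simp: bcontfun_def bounded_iff)
  have "norm (f x * g x) \<le> a * b" for x
    by (rule order_trans[OF norm_mult_ineq])
      (intro mult_mono ab norm_ge_zero order_trans[OF norm_ge_zero ab(1)])
  with assms show ?thesis
    by (intro bcontfun_normI) (auto simp: bcontfun_def intro!: continuous_intros)
qed

instantiation bcontfun :: (topological_space, real_normed_algebra) real_normed_algebra
begin

definition times_bcontfun :: "('a \<Rightarrow>\<^sub>C 'b) \<Rightarrow> ('a \<Rightarrow>\<^sub>C 'b) \<Rightarrow> ('a \<Rightarrow>\<^sub>C 'b)"
  where "times_bcontfun f g = Bcontfun (\<lambda>x. f x * g x)"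

lemma apply_bcontfun_times [simp]: "apply_bcontfun (f * g) x = f x * g x"
  for f g :: "'a \<Rightarrow>\<^sub>C 'b"
  by (simp add: times_bcontfun_def Bcontfun_inverse mult_bcontfun_cont apply_bcontfun)

instance
proof
  fix f g h :: "'a \<Rightarrow>\<^sub>C 'b" and r :: real
  show "f * g * h = f * (g * h)"
    by (rule bcontfun_eqI) (simp add: mult.assoc)
  show "(f + g) * h = f * h + g * h" "f * (g + h) = f * g + f * h"
    by (rule bcontfun_eqI, simp add: algebra_simps)+
  show "r *\<^sub>R f * g = r *\<^sub>R (f * g)" "f * r *\<^sub>R g = r *\<^sub>R (f * g)"
    by (rule bcontfun_eqI, simp)+
  show "norm (f * g) \<le> norm f * norm g"
    by (rule norm_bound, simp, rule order_trans[OF norm_mult_ineq])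
      (intro mult_mono norm_bounded norm_ge_zero)
qed

end

instance bcontfun :: (topological_space, "{real_normed_algebra, comm_ring}") comm_ring
  by standard (auto intro!: bcontfun_eqI simp: mult.commute algebra_simps)

inductive_set generated_algebra :: "('a::topological_space \<Rightarrow>\<^sub>C complex) set \<Rightarrow> ('a \<Rightarrow>\<^sub>C complex) set"
  for G where
  zero: "0 \<in> generated_algebra G"
| base: "f \<in> G \<Longrightarrow> f \<in> generated_algebra G"
| add: "f \<in> generated_algebra G \<Longrightarrow> g \<in> generated_algebra G \<Longrightarrow> f + g \<in> generated_algebra G"
| scale: "f \<in> generated_algebra G \<Longrightarrow> const_bcontfun c * f \<in> generated_algebra G"
| mult: "f \<in> generated_algebra G \<Longrightarrow> g \<in> generated_algebra G \<Longrightarrow> f * g \<in> generated_algebra G"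

text \<open>
  The nonzero multiplicative linear functionals on a subalgebra \<open>A\<close> of \<open>C(S)\<close>.
  A functional on \<open>A\<close> is a HOL function that is \<open>undefined\<close> outside \<open>A\<close>.
\<close>

definition spectrum ::
    "('a::topological_space \<Rightarrow>\<^sub>C complex) set \<Rightarrow> (('a \<Rightarrow>\<^sub>C complex) \<Rightarrow> complex) set" where
  "spectrum A = {\<mu> \<in> extensional A.
     (\<forall>f\<in>A. \<forall>g\<in>A. \<mu> (f + g) = \<mu> f + \<mu> g) \<and>
     (\<forall>c. \<forall>f\<in>A. \<mu> (const_bcontfun c * f) = c * \<mu> f) \<and>
     (\<forall>f\<in>A. \<forall>g\<in>A. \<mu> (f * g) = \<mu> f * \<mu> g) \<and>
     (\<exists>f\<in>A. \<mu> f \<noteq> 0)}"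

text \<open>The semigroup operation is written additively, to fit \<open>(\<int>, +)\<close>.\<close>

class semitopological_semigroup_add = topological_space + semigroup_add +
  assumes open_vimage_left_translation: "open U \<Longrightarrow> open ((\<lambda>t. s + t) -` U)"
    and open_vimage_right_translation: "open U \<Longrightarrow> open ((\<lambda>t. t + s) -` U)"

lemma continuous_left_translation:
  "continuous_on UNIV (\<lambda>t. s + t :: 'a::semitopological_semigroup_add)"
  by (simp add: continuous_on_open_vimage open_vimage_left_translation)

instance int :: semitopological_semigroup_add
  by standard (simp_all add: open_discrete)

definition left_translate ::
    "'a::semitopological_semigroup_add \<Rightarrow> ('a \<Rightarrow>\<^sub>C complex) \<Rightarrow> ('a \<Rightarrow>\<^sub>C complex)" where
  "left_translate s f = Bcontfun (\<lambda>t. f (s + t))"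

lemma apply_left_translate [simp]: "apply_bcontfun (left_translate s f) t = f (s + t)"
proof -
  have "(\<lambda>t. f (s + t)) \<in> bcontfun"
    by (rule bcontfun_normI[where b = "norm f"])
      (auto intro: continuous_on_compose2[OF continuous_on_apply_bcontfun continuous_left_translation]
        norm_bounded)
  then show ?thesis
    by (simp add: left_translate_def Bcontfun_inverse)
qed

definition LMC :: "('a::semitopological_semigroup_add \<Rightarrow>\<^sub>C complex) set" where
  "LMC = {f. \<forall>\<mu>\<in>spectrum UNIV. continuous_on UNIV (\<lambda>s. \<mu> (left_translate s f))}"

text \<open>
  \<open>T \<mu> f\<close> is given as a plain function on \<open>S\<close>; for \<open>f \<in> LMC\<close> and
  \<open>\<mu> \<in> spectrum LMC\<close> it again belongs to \<open>LMC\<close>.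
\<close>

definition T ::
    "(('a::semitopological_semigroup_add \<Rightarrow>\<^sub>C complex) \<Rightarrow> complex) \<Rightarrow> ('a \<Rightarrow>\<^sub>C complex) \<Rightarrow> 'a \<Rightarrow> complex" where
  "T \<mu> f = (\<lambda>s. \<mu> (left_translate s f))"

definition Sigma_LMC ::
    "(('a::semitopological_semigroup_add \<Rightarrow>\<^sub>C complex) \<Rightarrow> 'a \<Rightarrow> complex) set" where
  "Sigma_LMC = T ` spectrum LMC"

primrec F :: "nat \<Rightarrow> ('a::semitopological_semigroup_add \<Rightarrow>\<^sub>C complex) set" where
  "F 0 = {const_bcontfun c | c. norm c = 1}"
| "F (Suc k) = {f \<in> LMC. (\<forall>s. norm (f s) = 1) \<and>
     (\<forall>\<sigma>\<in>Sigma_LMC. \<exists>g\<in>F k. \<sigma> f = apply_bcontfun (g * f))}"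

definition W_level :: "nat \<Rightarrow> ('a::semitopological_semigroup_add \<Rightarrow>\<^sub>C complex) set" where
  "W_level k = closure (generated_algebra (F k))"

definition W :: "('a::semitopological_semigroup_add \<Rightarrow>\<^sub>C complex) set" where
  "W = closure (generated_algebra (\<Union>k\<in>{1..}. F k))"

end

theory Submission
  imports Defs
begin

text \<open>
  The idea is that \<open>F k\<close> on \<open>\<int>\<close> consists exactly of the polynomial phases \<open>n \<mapsto> cis (p n)\<close> with
  \<open>p\<close> a real polynomial of degree at most \<open>k\<close>. The functional \<open>f \<mapsto> f 1\<close> yields the
  equation \<open>f (n + 1) = g n * f n\<close> with \<open>g \<in> F (k - 1)\<close>, whose solutions are found by
  antidifferencing polynomials. Conversely, write \<open>p (s + t) = (\<Sum>j\<le>k. q j t * s ^ j)\<close>; a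
  multiplicative functional sends each unimodular function \<open>cis \<circ> q j\<close> to a number of modulus
  one, so that applying it in \<open>t\<close> gives again a polynomial phase in \<open>s\<close>, with the same leading
  coefficient because \<open>q k\<close> is constant.
\<close>

section \<open>Polynomial phases and functions on discrete spaces\<close>

definition phase :: "(nat \<Rightarrow> real) \<Rightarrow> nat \<Rightarrow> int \<Rightarrow> complex" where
  "phase a k n = cis (\<Sum>i\<le>k. a i * of_int n ^ i)"

lemma norm_phase [simp]: "norm (phase a k n) = 1"
  by (simp add: phase_def)

lemma phase_nonzero [simp]: "phase a k n \<noteq> 0"
  by (simp add: phase_def)

lemma unimodular_eq_cis: "norm (z::complex) = 1 \<Longrightarrow> z = cis (Arg z)"
  by (metis cis_Arg_unique rcis_cmod_Arg rcis_def mult_1 of_real_1)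

lemma discrete_bcontfun:
  fixes u :: "'a::discrete_topology \<Rightarrow> 'b::real_normed_vector"
  assumes "\<And>x. norm (u x) \<le> b"
  shows "u \<in> bcontfun"
  by (rule bcontfun_normI[where b = b]) (use assms in auto)

lemma LMC_discrete [simp]:
  "(LMC :: ('a::{semitopological_semigroup_add,discrete_topology} \<Rightarrow>\<^sub>C complex) set) = UNIV"
  by (auto simp: LMC_def)

section \<open>Multiplicative functionals on unimodular functions\<close>

lemma spectrum_const_1:
  assumes "\<mu> \<in> spectrum UNIV"
  shows "\<mu> (const_bcontfun 1) = 1"
proof -
  obtain f where f: "\<mu> f \<noteq> 0"
    using assms by (auto simp: spectrum_def)
  have "const_bcontfun 1 * f = f"
    by (rule bcontfun_eqI) simp
  moreover have "\<mu> (const_bcontfun 1 * f) = \<mu> (const_bcontfun 1) * \<mu> f"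
    using assms by (simp add: spectrum_def)
  ultimately show ?thesis
    using f by simp
qed

lemma spectrum_const:
  fixes \<mu> :: "('a::topological_space \<Rightarrow>\<^sub>C complex) \<Rightarrow> complex"
  assumes "\<mu> \<in> spectrum UNIV"
  shows "\<mu> (const_bcontfun c) = c"
proof -
  have "\<mu> (const_bcontfun c) = \<mu> (const_bcontfun c * const_bcontfun 1)"
    by (intro arg_cong[where f = \<mu>] bcontfun_eqI) simp
  also have "\<dots> = c * \<mu> (const_bcontfun 1)"
    using assms unfolding spectrum_def by blast
  finally show ?thesis
    using spectrum_const_1[OF assms] by simp
qed

text \<open>If \<open>\<mu> u\<close> had modulus other than one, \<open>u - \<mu> u\<close> would be invertible and yet in the kernel of \<open>\<mu>\<close>.\<close>

lemma norm_spectrum_unimodular: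
  fixes u :: "'a::discrete_topology \<Rightarrow>\<^sub>C complex"
  assumes mu: "\<mu> \<in> spectrum UNIV" and u: "\<And>x. norm (u x) = 1"
  shows "norm (\<mu> u) = 1"
proof (rule ccontr)
  assume ne: "norm (\<mu> u) \<noteq> 1"
  define c where "c = \<mu> u"
  \<comment> \<open>The bound does not depend on \<open>x\<close>, so the pointwise inverse of
    \<open>u - c\<close> is bounded and lies in the algebra.\<close>
  have low: "\<bar>1 - norm c\<bar> \<le> norm (u x - c)" for x
    using norm_triangle_ineq3[of "u x" c] u[of x] by simp
  have pos: "\<bar>1 - norm c\<bar> > 0"
    using ne by (simp add: c_def)
  have "norm (inverse (u x - c)) \<le> inverse \<bar>1 - norm c\<bar>" for x
    using low[of x] pos by (simp add: norm_inverse le_imp_inverse_le)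
  then have inv: "(\<lambda>x. inverse (u x - c)) \<in> bcontfun"
    by (rule discrete_bcontfun)
  define v where "v = Bcontfun (\<lambda>x. inverse (u x - c))"
  have "u x - c \<noteq> 0" for x
    using low[of x] pos by auto
  then have one: "(u + const_bcontfun (- c)) * v = const_bcontfun 1"
    by (intro bcontfun_eqI) (simp add: v_def Bcontfun_inverse[OF inv])
  have "\<mu> (u + const_bcontfun (- c)) = \<mu> u + \<mu> (const_bcontfun (- c))"
    using mu by (simp add: spectrum_def)
  then have "\<mu> (u + const_bcontfun (- c)) = 0"
    by (simp add: spectrum_const[OF mu] c_def)
  moreover have "\<mu> ((u + const_bcontfun (- c)) * v) = \<mu> (u + const_bcontfun (- c)) * \<mu> v"
    using mu by (simp add: spectrum_def)
  ultimately show False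
    using one spectrum_const_1[OF mu] by simp
qed

lemma cis_bcontfun [simp]: "(\<lambda>x::'a::discrete_topology. cis (g x)) \<in> bcontfun"
  by (rule discrete_bcontfun[where b = 1]) simp

lemma spectrum_cis_add:
  fixes g h :: "'a::discrete_topology \<Rightarrow> real"
  assumes "\<mu> \<in> spectrum UNIV"
  shows "\<mu> (Bcontfun (\<lambda>x. cis (g x + h x))) = \<mu> (Bcontfun (\<lambda>x. cis (g x))) * \<mu> (Bcontfun (\<lambda>x. cis (h x)))"
proof -
  have "Bcontfun (\<lambda>x. cis (g x + h x)) = Bcontfun (\<lambda>x. cis (g x)) * Bcontfun (\<lambda>x. cis (h x))"
    by (rule bcontfun_eqI) (simp add: Bcontfun_inverse cis_mult)
  then show ?thesis
    using assms by (simp add: spectrum_def)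
qed

lemma spectrum_cis_const:
  assumes "\<mu> \<in> spectrum (UNIV :: ('a::discrete_topology \<Rightarrow>\<^sub>C complex) set)"
  shows "\<mu> (Bcontfun (\<lambda>x. cis c)) = cis c"
proof -
  have "Bcontfun (\<lambda>x::'a. cis c) = const_bcontfun (cis c)"
    by (rule bcontfun_eqI) (simp add: Bcontfun_inverse)
  then show ?thesis
    using spectrum_const[OF assms] by simp
qed

lemma spectrum_cis_sum:
  fixes g :: "'i \<Rightarrow> 'a::discrete_topology \<Rightarrow> real"
  assumes "\<mu> \<in> spectrum UNIV" "finite A"
  shows "\<mu> (Bcontfun (\<lambda>x. cis (\<Sum>j\<in>A. g j x))) = (\<Prod>j\<in>A. \<mu> (Bcontfun (\<lambda>x. cis (g j x))))"
  using assms(2)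
proof (induction A rule: finite_induct)
  case empty
  then show ?case
    using spectrum_cis_const[OF assms(1), of 0] by simp
next
  case (insert j A)
  then show ?case
    by (simp add: spectrum_cis_add[OF assms(1)])
qed

lemma spectrum_cis_of_nat:
  fixes g :: "'a::discrete_topology \<Rightarrow> real"
  assumes "\<mu> \<in> spectrum UNIV"
  shows "\<mu> (Bcontfun (\<lambda>x. cis (g x * of_nat m))) = \<mu> (Bcontfun (\<lambda>x. cis (g x))) ^ m"
proof (induction m)
  case 0
  then show ?case
    using spectrum_cis_const[OF assms, of 0] by simp
next
  case (Suc m)
  then show ?case
    by (simp add: ring_distribs spectrum_cis_add[OF assms])
qed

text \<open>Multiplicativity controls integer powers only. This is enough on the integers, where the
  powers \<open>s ^ j\<close> that multiply the coefficients are integers.\<close>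

lemma spectrum_cis_of_int:
  fixes g :: "'a::discrete_topology \<Rightarrow> real"
  assumes mu: "\<mu> \<in> spectrum UNIV"
    and b: "\<mu> (Bcontfun (\<lambda>x. cis (g x))) = cis b"
  shows "\<mu> (Bcontfun (\<lambda>x. cis (g x * of_int m))) = cis (b * of_int m)"
proof (cases "m \<ge> 0")
  case True
  then show ?thesis
    using spectrum_cis_of_nat[OF mu, of g "nat m"] by (simp add: b Complex.DeMoivre mult.commute)
next
  case False
  \<comment> \<open>For negative \<open>m\<close>, multiplying by the natural power with exponent
    \<open>- m\<close> cancels the angle and leaves the constant \<open>1\<close>.\<close>
  have "\<mu> (Bcontfun (\<lambda>x. cis (g x * of_int m))) * cis (b * of_nat (nat (- m)))
    = \<mu> (Bcontfun (\<lambda>x. cis (g x * of_int m))) * \<mu> (Bcontfun (\<lambda>x. cis (g x * of_nat (nat (- m)))))"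
    by (simp add: spectrum_cis_of_nat[OF mu] b Complex.DeMoivre mult.commute)
  also have "\<dots> = \<mu> (Bcontfun (\<lambda>x. cis (g x * of_int m + g x * of_nat (nat (- m)))))"
    by (simp add: spectrum_cis_add[OF mu])
  also have "\<dots> = cis 0"
    using False spectrum_cis_const[OF mu, of 0] by (simp add: algebra_simps)
  finally have "\<mu> (Bcontfun (\<lambda>x. cis (g x * of_int m))) * cis (- (b * of_int m)) = 1"
    using False by simp
  then show ?thesis
    by (simp flip: cis_inverse add: field_simps)
qed

section \<open>Translates of polynomial phases and their images under \<open>T \<mu>\<close>\<close>

lemma polynomial_translate:
  fixes a :: "nat \<Rightarrow> 'a::comm_semiring_1"
  shows "(\<Sum>i\<le>k. a i * (s + t) ^ i)
    = (\<Sum>j\<le>k. (\<Sum>i=j..k. a i * of_nat (i choose j) * t ^ (i - j)) * s ^ j)"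
proof -
  have "(\<Sum>i\<le>k. a i * (s + t) ^ i)
      = (\<Sum>i\<le>k. \<Sum>j\<le>i. a i * of_nat (i choose j) * t ^ (i - j) * s ^ j)"
    by (simp add: binomial_ring sum_distrib_left mult_ac)
  also have "\<dots> = (\<Sum>j\<le>k. \<Sum>i=j..k. a i * of_nat (i choose j) * t ^ (i - j) * s ^ j)"
    \<comment> \<open>Both double sums run over the triangle
      \<open>j \<le> i \<le> k\<close>.\<close>
    unfolding sum.Sigma[OF finite_atMost ballI[OF finite_atMost]]
      sum.Sigma[OF finite_atMost ballI[OF finite_atLeastAtMost]]
    by (rule sum.reindex_bij_witness[where i = "\<lambda>(j, i). (i, j)" and j = "\<lambda>(i, j). (j, i)"]) auto
  finally show ?thesis
    by (simp add: sum_distrib_right)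
qed

text \<open>Keeping the top coefficient is the point: it makes the quotient of
  \<open>T \<mu> f\<close> by \<open>f\<close> a phase of lower degree.\<close>

lemma T_phase:
  assumes mu: "\<mu> \<in> spectrum UNIV" and f: "apply_bcontfun f = phase a k"
  shows "\<exists>b. b k = a k \<and> T \<mu> f = phase b k"
proof -
  define q where "q j (t::int) = (\<Sum>i=j..k. a i * of_nat (i choose j) * of_int t ^ (i - j))" for j t
  have "norm (\<mu> (Bcontfun (\<lambda>t. cis (q j t)))) = 1" for j
    by (rule norm_spectrum_unimodular[OF mu]) (simp add: Bcontfun_inverse)
  then have "\<mu> (Bcontfun (\<lambda>t. cis (q j t))) = cis (Arg (\<mu> (Bcontfun (\<lambda>t. cis (q j t)))))" for j
    by (rule unimodular_eq_cis)
  moreover have "\<mu> (Bcontfun (\<lambda>t. cis (q k t))) = cis (a k)"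
    by (simp add: q_def spectrum_cis_const[OF mu])
  \<comment> \<open>Angles are determined only modulo \<open>2 * pi\<close>; at \<open>j = k\<close>
    the choice is \<open>a k\<close> itself, so that the top coefficients agree exactly.\<close>
  ultimately have "\<forall>j. \<exists>r. \<mu> (Bcontfun (\<lambda>t. cis (q j t))) = cis r \<and> (j = k \<longrightarrow> r = a k)"
    by metis
  then obtain b where b: "\<And>j. \<mu> (Bcontfun (\<lambda>t. cis (q j t))) = cis (b j)" "b k = a k"
    by metis
  have "T \<mu> f s = phase b k s" for s
  proof -
    have "left_translate s f = Bcontfun (\<lambda>t. cis (\<Sum>j\<le>k. q j t * of_int (s ^ j)))"
      by (rule bcontfun_eqI)
        (simp add: Bcontfun_inverse f phase_def polynomial_translate q_def)
    then have "T \<mu> f s = (\<Prod>j\<le>k. cis (b j * of_int (s ^ j)))"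
      by (simp only: T_def spectrum_cis_sum[OF mu finite_atMost] spectrum_cis_of_int[OF mu b(1)])
    also have "\<dots> = phase b k s"
      by (induction k) (simp_all add: phase_def cis_mult)
    finally show ?thesis .
  qed
  then show ?thesis
    using b(2) by blast
qed

section \<open>The first-order difference equation\<close>

lemma polynomial_antidifference:
  fixes a :: "nat \<Rightarrow> 'a::field_char_0"
  shows "\<exists>b. \<forall>x. (\<Sum>i\<le>Suc d. b i * (x + 1) ^ i) = (\<Sum>i\<le>d. a i * x ^ i) + (\<Sum>i\<le>Suc d. b i * x ^ i)"
proof (induction d arbitrary: a)
  case 0
  show ?case
    by (rule exI[where x = "\<lambda>_. a 0"]) (simp add: algebra_simps)
next
  case (Suc d)
  \<comment> \<open>With this \<open>c\<close>, the difference of \<open>c * x ^ Suc (Suc d)\<close>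
    has leading term \<open>a (Suc d) * x ^ Suc d\<close>. Its lower binomial terms are subtracted
    from \<open>a\<close> before the induction hypothesis is applied.\<close>
  define c where "c = a (Suc d) / of_nat (Suc (Suc d))"
  obtain b where b: "\<And>x. (\<Sum>i\<le>Suc d. b i * (x + 1) ^ i)
      = (\<Sum>i\<le>d. (a i - c * of_nat (Suc (Suc d) choose i)) * x ^ i) + (\<Sum>i\<le>Suc d. b i * x ^ i)"
    using Suc.IH[of "\<lambda>i. a i - c * of_nat (Suc (Suc d) choose i)"] by blast
  define b' where "b' = b(Suc (Suc d) := c)"
  have split: "(\<Sum>i\<le>Suc (Suc d). b' i * y ^ i) = (\<Sum>i\<le>Suc d. b i * y ^ i) + c * y ^ Suc (Suc d)" for y
    unfolding b'_def sum.atMost_Suc[of _ "Suc d"]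
    by (intro arg_cong2[where f = "(+)"] sum.cong) auto
  have top: "c * of_nat (Suc (Suc d)) = a (Suc d)"
    unfolding c_def using of_nat_neq_0[of "Suc d", where 'a = 'a] by (simp del: of_nat_Suc)
  have bin: "c * (x + 1) ^ Suc (Suc d) = (\<Sum>i\<le>d. c * of_nat (Suc (Suc d) choose i) * x ^ i)
      + a (Suc d) * x ^ Suc d + c * x ^ Suc (Suc d)" for x
  proof -
    have "(x + 1) ^ Suc (Suc d) = (\<Sum>i\<le>Suc (Suc d). of_nat (Suc (Suc d) choose i) * x ^ i)"
      unfolding binomial_ring[of x 1] by simp
    also have "\<dots> = (\<Sum>i\<le>d. of_nat (Suc (Suc d) choose i) * x ^ i)
        + of_nat (Suc (Suc d)) * x ^ Suc d + x ^ Suc (Suc d)"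
      unfolding sum.atMost_Suc by (simp only: binomial_n_n binomial_Suc_n of_nat_1 mult_1)
    finally show ?thesis
      by (simp only: distrib_left sum_distrib_left flip: mult.assoc top)
  qed
  have "(\<Sum>i\<le>Suc (Suc d). b' i * (x + 1) ^ i)
      = (\<Sum>i\<le>Suc d. a i * x ^ i) + (\<Sum>i\<le>Suc (Suc d). b' i * x ^ i)" for x
    unfolding split b bin sum.atMost_Suc[of _ d]
    by (simp only: left_diff_distrib sum_subtractf) (simp add: algebra_simps)
  then show ?case
    by blast
qed

lemma int_periodic_const:
  fixes h :: "int \<Rightarrow> 'a"
  assumes "\<And>n. h (n + 1) = h n"
  shows "h n = h 0"
proof (induction n rule: int_induct[where k = 0])
  case (step1 i)
  then show ?case using assms[of i] by simp
next
  case (step2 i)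
  then show ?case using assms[of "i - 1"] by simp
qed simp

text \<open>An antidifference of the exponent gives one solution. The quotient of \<open>f\<close>
  by it has period \<open>1\<close>, hence is a constant of modulus one, which is absorbed into the
  coefficient of degree \<open>0\<close>.\<close>

lemma phase_recurrence:
  assumes f: "\<And>n. norm (f n) = 1" and rec: "\<And>n. f (n + 1) = phase a k n * f n"
  shows "\<exists>b. f = phase b (Suc k)"
proof -
  obtain b where b: "\<And>x::real. (\<Sum>i\<le>Suc k. b i * (x + 1) ^ i)
      = (\<Sum>i\<le>k. a i * x ^ i) + (\<Sum>i\<le>Suc k. b i * x ^ i)"
    using polynomial_antidifference by blast
  have "phase b (Suc k) (n + 1) = phase a k n * phase b (Suc k) n" for n
    using b[of "of_int n"] by (simp only: phase_def cis_mult of_int_add of_int_1)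
  then have "f (n + 1) / phase b (Suc k) (n + 1) = f n / phase b (Suc k) n" for n
    by (simp add: rec)
  from int_periodic_const[of "\<lambda>n. f n / phase b (Suc k) n", OF this]
  have quot: "f n / phase b (Suc k) n = f 0 / phase b (Suc k) 0" for n .
  define c where "c = Arg (f 0 / phase b (Suc k) 0)"
  have "f 0 / phase b (Suc k) 0 = cis c"
    unfolding c_def by (rule unimodular_eq_cis) (simp add: norm_divide f)
  then have "f n = cis c * phase b (Suc k) n" for n
    using quot[of n] by (simp add: divide_eq_eq)
  also have "cis c * phase b (Suc k) n = phase (b(0 := c + b 0)) (Suc k) n" for n
    by (simp add: phase_def cis_mult sum.atMost_shift add.assoc)
  finally show ?thesis
    by blast
qed

section \<open>The sets \<open>F k\<close> on the integers\<close>

lemma eval_in_spectrum: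
  "restrict (\<lambda>f. apply_bcontfun f x) UNIV \<in> spectrum UNIV"
  by (auto simp: spectrum_def intro!: exI[where x = "const_bcontfun 1"])

lemma F_int_eq_phase:
  "(F k :: (int \<Rightarrow>\<^sub>C complex) set) = {f. \<exists>a. apply_bcontfun f = phase a k}"
proof (induction k)
  case 0
  show ?case
  proof (intro set_eqI iffI; clarsimp)
    fix c :: complex
    assume "norm c = 1"
    then show "\<exists>a. (\<lambda>x. c) = phase a 0"
      by (intro exI[where x = "\<lambda>_. Arg c"]) (simp add: phase_def fun_eq_iff flip: unimodular_eq_cis)
  next
    fix f :: "int \<Rightarrow>\<^sub>C complex" and a
    assume "apply_bcontfun f = phase a 0"
    then have "f = const_bcontfun (cis (a 0))"
      by (intro bcontfun_eqI) (simp add: phase_def)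
    then show "\<exists>c. f = const_bcontfun c \<and> norm c = 1"
      by auto
  qed
next
  case (Suc k)
  show ?case
  proof (intro set_eqI iffI)
    fix f :: "int \<Rightarrow>\<^sub>C complex"
    assume fF: "f \<in> F (Suc k)"
    \<comment> \<open>Evaluation at the generator \<open>1\<close> turns \<open>T e\<close> into the
      unit shift, and this single functional already forces the recurrence.\<close>
    define e where "e = restrict (\<lambda>f :: int \<Rightarrow>\<^sub>C complex. f 1) UNIV"
    have "T e \<in> Sigma_LMC"
      unfolding Sigma_LMC_def LMC_discrete e_def by (intro imageI eval_in_spectrum)
    then obtain g where g: "g \<in> F k" "T e f = apply_bcontfun (g * f)"
      using fF by auto
    obtain a where a: "apply_bcontfun g = phase a k"
      using g(1) Suc.IH by auto
    have "f (n + 1) = phase a k n * f n" for n :: int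
      using fun_cong[OF g(2), of n] by (simp add: T_def e_def a)
    moreover have "norm (f n) = 1" for n :: int
      using fF by simp
    ultimately show "f \<in> {f. \<exists>a. apply_bcontfun f = phase a (Suc k)}"
      using phase_recurrence by blast
  next
    fix f :: "int \<Rightarrow>\<^sub>C complex"
    assume "f \<in> {f. \<exists>a. apply_bcontfun f = phase a (Suc k)}"
    then obtain a where a: "apply_bcontfun f = phase a (Suc k)"
      by blast
    have "\<exists>g\<in>F k. T \<mu> f = apply_bcontfun (g * f)" if mu: "\<mu> \<in> spectrum UNIV" for \<mu>
    proof -
      obtain b where b: "b (Suc k) = a (Suc k)" "T \<mu> f = phase b (Suc k)"
        using T_phase[OF mu a] by blast
      have bc: "phase c k \<in> bcontfun" for c
        by (rule discrete_bcontfun[where b = 1]) simp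
      \<comment> \<open>The coefficients of degree \<open>Suc k\<close> cancel, so stopping at
        degree \<open>k\<close> still gives the whole quotient of \<open>T \<mu> f\<close> by
        \<open>f\<close>.\<close>
      define g where "g = Bcontfun (phase (\<lambda>i. b i - a i) k)"
      have g: "apply_bcontfun g = phase (\<lambda>i. b i - a i) k"
        by (simp add: g_def Bcontfun_inverse bc)
      have "g \<in> F k"
        using g Suc.IH by auto
      moreover have "T \<mu> f = apply_bcontfun (g * f)"
        by (simp add: fun_eq_iff b a g)
          (simp add: phase_def cis_mult b left_diff_distrib sum_subtractf)
      ultimately show ?thesis ..
    qed
    then show "f \<in> F (Suc k)"
      by (simp add: Sigma_LMC_def a)
  qed
qed

section \<open>Comparison of the generated algebras\<close>

lemma generated_algebra_least:
  assumes "G \<subseteq> generated_algebra H"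
  shows "generated_algebra G \<subseteq> generated_algebra H"
proof
  fix f
  assume "f \<in> generated_algebra G"
  then show "f \<in> generated_algebra H"
    by induction (use assms in \<open>auto intro: generated_algebra.intros\<close>)
qed

text \<open>A phase is a product of monomial phases, one for each degree. Degree \<open>0\<close> is
  a scalar multiple of \<open>1\<close>, so only exponents from \<open>1\<close> on are demanded of
  \<open>G\<close>; thus the lemma serves both families of generators.\<close>

lemma phase_in_generated_algebra:
  fixes G :: "(int \<Rightarrow>\<^sub>C complex) set"
  assumes one: "const_bcontfun 1 \<in> G"
    and mono: "\<And>lam i f. norm lam = 1 \<Longrightarrow> 1 \<le> i \<Longrightarrow> i \<le> k \<Longrightarrow>
      apply_bcontfun f = (\<lambda>n. lam powi (n ^ i)) \<Longrightarrow> f \<in> G"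
    and f: "apply_bcontfun f = phase a k"
  shows "f \<in> generated_algebra G"
  using mono f
proof (induction k arbitrary: f)
  case 0
  have "f = const_bcontfun (cis (a 0)) * const_bcontfun 1"
    by (rule bcontfun_eqI) (simp add: "0.prems" phase_def)
  then show ?case
    using one by (auto intro: generated_algebra.intros)
next
  case (Suc k)
  define g h where "g = Bcontfun (phase a k)" and "h = Bcontfun (\<lambda>n. cis (a (Suc k) * of_int n ^ Suc k))"
  have g: "apply_bcontfun g = phase a k"
    unfolding g_def by (intro Bcontfun_inverse discrete_bcontfun[where b = 1]) simp
  have h: "apply_bcontfun h = (\<lambda>n. cis (a (Suc k) * of_int n ^ Suc k))"
    unfolding h_def by (intro Bcontfun_inverse cis_bcontfun)
  have "g \<in> generated_algebra G"
    using Suc.IH[OF _ g] Suc.prems(1) by simp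
  moreover have "h \<in> G"
    by (rule Suc.prems(1)[of "cis (a (Suc k))" "Suc k"])
      (simp_all add: h cis_power_int mult.commute del: power_Suc)
  moreover have "f = g * h"
    by (rule bcontfun_eqI) (simp add: Suc.prems(2) g h phase_def cis_mult)
  ultimately show ?case
    by (auto intro: generated_algebra.intros)
qed

lemma monomial_phase_in_F:
  fixes f :: "int \<Rightarrow>\<^sub>C complex"
  assumes "norm lam = 1" "i \<le> k" "apply_bcontfun f = (\<lambda>n. lam powi (n ^ i))"
  shows "f \<in> F k"
proof -
  \<comment> \<open>The angle of \<open>lam\<close> is the only coefficient, placed at degree
    \<open>i\<close>.\<close>
  have "lam powi (n ^ i) = phase (\<lambda>j. if j = i then Arg lam else 0) k n" for n
  proof -
    have "(\<Sum>j\<le>k. (if j = i then Arg lam else 0) * of_int n ^ j) = Arg lam * of_int n ^ i"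
      using assms(2) by (simp add: if_distrib[of "\<lambda>x. x * _"] cong: if_cong)
    then show ?thesis
      by (subst unimodular_eq_cis[OF assms(1)]) (simp add: phase_def cis_power_int mult.commute)
  qed
  then show ?thesis
    using assms(3) by (auto simp: F_int_eq_phase fun_eq_iff)
qed

theorem theorem4p2:
  shows "(\<forall>k::nat. k \<ge> 1 \<longrightarrow>
      (W_level k :: (int \<Rightarrow>\<^sub>C complex) set) =
        closure (generated_algebra
          {f. \<exists>(lam::complex) (i::nat). norm lam = 1 \<and> i \<le> k \<and>
                apply_bcontfun f = (\<lambda>n::int. lam powi (n ^ i))}))
    \<and> (W :: (int \<Rightarrow>\<^sub>C complex) set) =
        closure (generated_algebra
          {f. \<exists>(lam::complex) (k::nat). norm lam = 1 \<and> k \<ge> 1 \<and>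
                apply_bcontfun f = (\<lambda>n::int. lam powi (n ^ k))})"
    (is "(\<forall>k. _ \<longrightarrow> _ = closure (generated_algebra (?E k))) \<and> _ = closure (generated_algebra ?E')")
proof (intro conjI allI impI)
  fix k :: nat
  have one: "const_bcontfun 1 \<in> ?E k"
    by (auto intro!: exI[where x = "1 :: complex"] exI[where x = "0 :: nat"])
  have "F k \<subseteq> generated_algebra (?E k)"
    unfolding F_int_eq_phase using phase_in_generated_algebra[OF one] by blast
  moreover have "?E k \<subseteq> generated_algebra (F k)"
    by (auto intro: generated_algebra.base monomial_phase_in_F)
  ultimately show "W_level k = closure (generated_algebra (?E k))"
    unfolding W_level_def
    by (intro arg_cong[where f = closure] equalityI generated_algebra_least)
next
  \<comment> \<open>Exponent \<open>0\<close> is excluded here; the constant \<open>1\<close> comes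
    from \<open>lam = 1\<close> with exponent \<open>1\<close>.\<close>
  have one: "const_bcontfun 1 \<in> ?E'"
    by (auto intro!: exI[where x = 1])
  have "(\<Union>k\<in>{1..}. F k) \<subseteq> generated_algebra ?E'"
    unfolding F_int_eq_phase using phase_in_generated_algebra[OF one] by blast
  moreover have "?E' \<subseteq> generated_algebra (\<Union>k\<in>{1..}. F k)"
    by (auto intro!: generated_algebra.base intro: monomial_phase_in_F[OF _ order_refl])
  ultimately show "W = closure (generated_algebra ?E')"
    unfolding W_def
    by (intro arg_cong[where f = closure] equalityI generated_algebra_least)
qed

end
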